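(* (1) For every $n\ge3$, there is no hyperbolic helicoid of the second kind in Minkowski $n$-space $\mathbb{R}^n_1$. (2) There is no elliptic helicoid of the second kind in the four dimensional pseudo-Euclidean space $\mathbb{R}^4_2$ with the neutral metric.
   Context: $\mathbb{R}^n_p$ denotes $\mathbb{R}^n$ with the metric $\langle\cdot,\cdot\rangle_p=-\sum_{i=1}^p dx_i^2+\sum_{j=p+1}^n dx_j^2$. An orthogonal system is a set of non-zero vectors mutually orthogonal with respect to $\langle\cdot,\cdot\rangle_p$. A hyperbolic helicoid of the second kind in $\mathbb{R}^n_p$ is a surface $f(s,t)=(\cosh s\,e_1+\sinh s\,e_2)t+s e_3$, where $\{e_1,e_2,e_3\}\subset\mathbb{R}^n_p$ is an orthogonal system with $\langle e_1,e_1\rangle_p=-\langle e_2,e_2\rangle_p=\pm1$ and $\langle e_3,e_3\rangle_p=0$ (so $e_3\neq0$ is a null vector). An elliptic helicoid of the second kind in $\mathbb{R}^n_p$ is a surface $f(s,t)=(\cos s\,e_1+\sin s\,e_2)t+s e_3$, where $\{e_1,e_2,e_3\}\subset\mathbb{R}^n_p$ is an orthogonal system with $\langle e_1,e_1\rangle_p=\langle e_2,e_2\rangle_p=\pm1$ and $\langle e_3,e_3\rangle_p=0$ (so $e_3\ne0$ is a null vector). Thus the existence of such a surface means the existence of vectors $e_1,e_2,e_3$ as described. *)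

theory Defs
  imports Complex_Main "Jordan_Normal_Form.Matrix"
begin

text \<open>Points of the pseudo-Euclidean space of dimension \<open>n\<close> and index \<open>p\<close> are the elements of
  \<^term>\<open>carrier_vec n :: real vec set\<close>; the first \<open>p\<close> coordinates are the negative ones.
  Vectors are indexed from 0, so these are the coordinates \<open>i < p\<close>. Meaningful for \<open>p \<le> n\<close>.\<close>

definition pseudo_inner :: "nat \<Rightarrow> nat \<Rightarrow> real vec \<Rightarrow> real vec \<Rightarrow> real" where
  "pseudo_inner n p v w = - (\<Sum>i\<in>{0..<p}. v $ i * w $ i) + (\<Sum>i\<in>{p..<n}. v $ i * w $ i)"

definition orthogonal_system :: "nat \<Rightarrow> nat \<Rightarrow> real vec set \<Rightarrow> bool" where
  "orthogonal_system n p S \<longleftrightarrow>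
     S \<subseteq> carrier_vec n \<and> 0\<^sub>v n \<notin> S \<and> pairwise (\<lambda>v w. pseudo_inner n p v w = 0) S"

text \<open>Since \<^term>\<open>{e1, e2, e3}\<close> is a set, distinctness is stated separately: without it
  \<^term>\<open>e1 = e2\<close> would be admitted in the elliptic case, where \<open>e1\<close> and \<open>e2\<close> are meant to be
  orthogonal to each other.\<close>

definition hyperbolic_helicoid_second_kind ::
    "nat \<Rightarrow> nat \<Rightarrow> (real \<times> real \<Rightarrow> real vec) \<Rightarrow> bool" where
  "hyperbolic_helicoid_second_kind n p f \<longleftrightarrow>
     (\<exists>e1 e2 e3. distinct [e1, e2, e3] \<and> orthogonal_system n p {e1, e2, e3} \<and>
        pseudo_inner n p e1 e1 = - pseudo_inner n p e2 e2 \<and>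
        pseudo_inner n p e1 e1 \<in> {1, -1} \<and>
        pseudo_inner n p e3 e3 = 0 \<and>
        f = (\<lambda>(s, t). t \<cdot>\<^sub>v (cosh s \<cdot>\<^sub>v e1 + sinh s \<cdot>\<^sub>v e2) + s \<cdot>\<^sub>v e3))"

definition elliptic_helicoid_second_kind ::
    "nat \<Rightarrow> nat \<Rightarrow> (real \<times> real \<Rightarrow> real vec) \<Rightarrow> bool" where
  "elliptic_helicoid_second_kind n p f \<longleftrightarrow>
     (\<exists>e1 e2 e3. distinct [e1, e2, e3] \<and> orthogonal_system n p {e1, e2, e3} \<and>
        pseudo_inner n p e1 e1 = pseudo_inner n p e2 e2 \<and>
        pseudo_inner n p e1 e1 \<in> {1, -1} \<and>
        pseudo_inner n p e3 e3 = 0 \<and>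
        f = (\<lambda>(s, t). t \<cdot>\<^sub>v (cos s \<cdot>\<^sub>v e1 + sin s \<cdot>\<^sub>v e2) + s \<cdot>\<^sub>v e3))"

end

theory Submission imports Defs begin

text \<open>Both parts rest on one principle: a subspace on which the form is positive semidefinite meets
  the span of the negative coordinate axes, where the form is negative definite, only in \<open>0\<close>, and
  dually with the signs exchanged. Hence a semidefinite subspace is no larger in dimension than the
  number of axes of its own sign.

  In Minkowski space one of \<open>e1\<close>, \<open>e2\<close> is timelike whichever sign is chosen, and with the null vector
  \<open>e3\<close> orthogonal to it, it would span a negative semidefinite plane, although there is only one
  negative axis (\<open>timelike_orthogonal_null\<close>). In the neutral four-space \<open>e1\<close>, \<open>e2\<close>, \<open>e3\<close> would span a
  semidefinite space of dimension three, although there are only two axes of either sign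
  (\<open>definite_pair_orthogonal_null\<close>). In both cases the contradiction comes from a nontrivial linear
  combination whose coordinates on the axes of the same sign vanish; it must be \<open>0\<close>, and evaluating
  the form on it shows that the non-null vectors have coefficient \<open>0\<close>. Only \<open>e3\<close> remains, which
  then vanishes, although members of an orthogonal system are nonzero.\<close>

lemma pseudo_inner_commute: "pseudo_inner n p v w = pseudo_inner n p w v"
  by (simp add: pseudo_inner_def mult.commute)

lemma pseudo_inner_zero_left: "p \<le> n \<Longrightarrow> pseudo_inner n p (0\<^sub>v n) w = 0"
  by (simp add: pseudo_inner_def)

lemma pseudo_inner_add_left:
  assumes "p \<le> n" "u \<in> carrier_vec n" "v \<in> carrier_vec n"
  shows "pseudo_inner n p (u + v) w = pseudo_inner n p u w + pseudo_inner n p v w"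
  using assms by (simp add: pseudo_inner_def distrib_right sum.distrib)

lemma pseudo_inner_smult_left:
  assumes "p \<le> n" "v \<in> carrier_vec n"
  shows "pseudo_inner n p (a \<cdot>\<^sub>v v) w = a * pseudo_inner n p v w"
  using assms by (simp add: pseudo_inner_def sum_distrib_left algebra_simps)

lemma pseudo_inner_add_right:
  assumes "p \<le> n" "u \<in> carrier_vec n" "v \<in> carrier_vec n"
  shows "pseudo_inner n p w (u + v) = pseudo_inner n p w u + pseudo_inner n p w v"
  using pseudo_inner_add_left[OF assms] by (simp add: pseudo_inner_commute)

lemma pseudo_inner_smult_right:
  assumes "p \<le> n" "v \<in> carrier_vec n"
  shows "pseudo_inner n p w (a \<cdot>\<^sub>v v) = a * pseudo_inner n p w v"
  using pseudo_inner_smult_left[OF assms] by (simp add: pseudo_inner_commute)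

lemmas pseudo_inner_linear = pseudo_inner_add_left pseudo_inner_smult_left
  pseudo_inner_add_right pseudo_inner_smult_right

lemma positive_definite_on_positive_axes:
  assumes v: "v \<in> carrier_vec n" and zero: "\<And>i. i < p \<Longrightarrow> v $ i = 0"
    and q: "pseudo_inner n p v v \<le> 0"
  shows "v = 0\<^sub>v n"
proof -
  have "(\<Sum>i\<in>{p..<n}. v $ i * v $ i) \<le> 0"
    using q zero by (simp add: pseudo_inner_def)
  then have "(\<Sum>i\<in>{p..<n}. v $ i * v $ i) = 0"
    by (simp add: order_antisym sum_nonneg)
  then have "\<forall>i\<in>{p..<n}. v $ i = 0"
    by (simp add: sum_nonneg_eq_0_iff)
  then have "v $ i = 0" if "i < n" for i
    using zero that by (cases "i < p") auto
  then show ?thesis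
    using v by (intro eq_vecI) auto
qed

lemma negative_definite_on_negative_axes:
  assumes v: "v \<in> carrier_vec n" and zero: "\<And>i. p \<le> i \<Longrightarrow> i < n \<Longrightarrow> v $ i = 0"
    and q: "pseudo_inner n p v v \<ge> 0"
  shows "v = 0\<^sub>v n"
proof -
  have "(\<Sum>i\<in>{0..<p}. v $ i * v $ i) \<le> 0"
    using q zero by (simp add: pseudo_inner_def)
  then have "(\<Sum>i\<in>{0..<p}. v $ i * v $ i) = 0"
    by (simp add: order_antisym sum_nonneg)
  then have "\<forall>i\<in>{0..<p}. v $ i = 0"
    by (simp add: sum_nonneg_eq_0_iff)
  then have "v $ i = 0" if "i < n" for i
    using zero that by (cases "i < p") auto
  then show ?thesis
    using v by (intro eq_vecI) auto
qed

text \<open>The combination \<open>w $ 0 \<cdot> u - u $ 0 \<cdot> w\<close> has no time coordinate, so its square is nonnegative;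
  but orthogonality makes that square \<open>(w $ 0)\<^sup>2\<close> times the negative square of \<open>u\<close>. So \<open>w\<close> has
  no time coordinate either, and a null vector without time coordinate vanishes.\<close>

lemma timelike_orthogonal_null:
  assumes n: "1 \<le> n" and u: "u \<in> carrier_vec n" and w: "w \<in> carrier_vec n"
    and timelike: "pseudo_inner n 1 u u < 0"
    and orth: "pseudo_inner n 1 u w = 0" and null: "pseudo_inner n 1 w w = 0"
  shows "w = 0\<^sub>v n"
proof -
  define v where "v = (w $ 0) \<cdot>\<^sub>v u + (- (u $ 0)) \<cdot>\<^sub>v w"
  have v: "v \<in> carrier_vec n" and v0: "v $ 0 = 0"
    using n u w by (simp_all add: v_def)
  have orth': "pseudo_inner n 1 w u = 0"
    using orth by (simp add: pseudo_inner_commute)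
  have q: "pseudo_inner n 1 v v = (w $ 0)\<^sup>2 * pseudo_inner n 1 u u"
    using n u w orth orth' null
    by (simp add: v_def pseudo_inner_linear power2_eq_square del: One_nat_def)
  then have "pseudo_inner n 1 v v \<le> 0"
    using timelike by (simp add: mult_nonneg_nonpos)
  then have "v = 0\<^sub>v n"
    using v v0 by (intro positive_definite_on_positive_axes[of v n 1]) auto
  then have "pseudo_inner n 1 v v = 0"
    using n by (simp add: pseudo_inner_zero_left del: One_nat_def)
  with q timelike have "w $ 0 = 0"
    by simp
  then show ?thesis
    using w null by (intro positive_definite_on_positive_axes[of w n 1]) auto
qed

lemma two_homogeneous_equations_three_unknowns:
  fixes x1 x2 x3 y1 y2 y3 :: real
  obtains a b c where "(a, b, c) \<noteq> (0, 0, 0)"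
    "a * x1 + b * x2 + c * x3 = 0" "a * y1 + b * y2 + c * y3 = 0"
proof (cases "x1 * y2 - x2 * y1 = 0")
  case False
  \<comment> \<open>The cross product of the two coefficient rows.\<close>
  show ?thesis
    by (rule that[of "x2 * y3 - x3 * y2" "x3 * y1 - x1 * y3" "x1 * y2 - x2 * y1"])
      (use False in \<open>simp_all add: algebra_simps\<close>)
next
  \<comment> \<open>The first two columns are dependent, so a solution with third component \<open>0\<close> exists.\<close>
  case True
  consider "x1 \<noteq> 0 \<or> x2 \<noteq> 0" | "y1 \<noteq> 0 \<or> y2 \<noteq> 0" | "x1 = 0" "x2 = 0" "y1 = 0" "y2 = 0"
    by blast
  then show ?thesis
  proof cases
    case 1
    then show ?thesis
      using True by (intro that[of x2 "- x1" 0]) (auto simp: algebra_simps)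
  next
    case 2
    then show ?thesis
      using True by (intro that[of y2 "- y1" 0]) (auto simp: algebra_simps)
  next
    case 3
    then show ?thesis
      by (intro that[of 1 0 0]) auto
  qed
qed

text \<open>The two coordinates \<open>i\<close> and \<open>j\<close> stand for the axes on which the form has the sign \<open>\<sigma>\<close>:
  \<open>definite\<close> says that \<open>\<sigma>\<close> times the form is negative definite once they vanish. Keeping \<open>\<sigma>\<close> abstract
  treats the spacelike and the timelike pair together. Some nontrivial combination of the three
  vectors has both coordinates zero, while \<open>\<sigma>\<close> times its square is \<open>a\<^sup>2 + b\<^sup>2\<close>.\<close>

lemma definite_pair_orthogonal_null:
  assumes p: "p \<le> n" and ij: "i < n" "j < n" and \<sigma>: "\<sigma> \<in> {1, -1}"
    and definite: "\<And>v. v \<in> carrier_vec n \<Longrightarrow> v $ i = 0 \<Longrightarrow> v $ j = 0 \<Longrightarrow>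
      \<sigma> * pseudo_inner n p v v \<ge> 0 \<Longrightarrow> v = 0\<^sub>v n"
    and e: "e1 \<in> carrier_vec n" "e2 \<in> carrier_vec n" "e3 \<in> carrier_vec n"
    and orth: "pseudo_inner n p e1 e2 = 0" "pseudo_inner n p e1 e3 = 0" "pseudo_inner n p e2 e3 = 0"
    and unit: "pseudo_inner n p e1 e1 = \<sigma>" "pseudo_inner n p e2 e2 = \<sigma>"
    and null: "pseudo_inner n p e3 e3 = 0"
  shows "e3 = 0\<^sub>v n"
proof -
  obtain a b c where abc: "(a, b, c) \<noteq> (0, 0, 0)"
    "a * e1 $ i + b * e2 $ i + c * e3 $ i = 0" "a * e1 $ j + b * e2 $ j + c * e3 $ j = 0"
    by (rule two_homogeneous_equations_three_unknowns)
  define v where "v = a \<cdot>\<^sub>v e1 + b \<cdot>\<^sub>v e2 + c \<cdot>\<^sub>v e3"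
  have v: "v \<in> carrier_vec n" "v $ i = 0" "v $ j = 0"
    using e ij abc by (simp_all add: v_def)
  have orth': "pseudo_inner n p e2 e1 = 0" "pseudo_inner n p e3 e1 = 0" "pseudo_inner n p e3 e2 = 0"
    using orth by (simp_all add: pseudo_inner_commute)
  have "pseudo_inner n p v v = \<sigma> * (a\<^sup>2 + b\<^sup>2)"
    using p e orth orth' unit null
    by (simp add: v_def pseudo_inner_linear power2_eq_square algebra_simps)
  then have q: "\<sigma> * pseudo_inner n p v v = a\<^sup>2 + b\<^sup>2"
    using \<sigma> by auto
  then have v_zero: "v = 0\<^sub>v n"
    using v by (intro definite) simp_all
  then have "pseudo_inner n p v v = 0"
    using p by (simp add: pseudo_inner_zero_left)
  with q have "a = 0" "b = 0"
    by (simp_all add: sum_power2_eq_zero_iff)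
  with abc(1) have "c \<noteq> 0"
    by simp
  have "e3 $ k = 0" if "k < n" for k
  proof -
    have "v $ k = c * e3 $ k"
      using e that \<open>a = 0\<close> \<open>b = 0\<close> by (simp add: v_def)
    then show ?thesis
      using v_zero that \<open>c \<noteq> 0\<close> by simp
  qed
  then show ?thesis
    using e by (intro eq_vecI) auto
qed

lemma orthogonal_system_tripleD:
  assumes "distinct [e1, e2, e3]" "orthogonal_system n p {e1, e2, e3}"
  shows "e1 \<in> carrier_vec n" "e2 \<in> carrier_vec n" "e3 \<in> carrier_vec n" "e3 \<noteq> 0\<^sub>v n"
    "pseudo_inner n p e1 e2 = 0" "pseudo_inner n p e1 e3 = 0" "pseudo_inner n p e2 e3 = 0"
  using assms by (auto simp: orthogonal_system_def pairwise_def)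

lemma no_hyperbolic_helicoid_second_kind_Minkowski:
  assumes "1 \<le> n"
  shows "\<not> hyperbolic_helicoid_second_kind n 1 f"
proof
  assume "hyperbolic_helicoid_second_kind n 1 f"
  then obtain e1 e2 e3 where
    sys: "distinct [e1, e2, e3]" "orthogonal_system n 1 {e1, e2, e3}"
    and opp: "pseudo_inner n 1 e1 e1 = - pseudo_inner n 1 e2 e2"
    and unit: "pseudo_inner n 1 e1 e1 \<in> {1, -1}"
    and null: "pseudo_inner n 1 e3 e3 = 0"
    unfolding hyperbolic_helicoid_second_kind_def by blast
  note D = orthogonal_system_tripleD[OF sys]
  consider "pseudo_inner n 1 e1 e1 < 0" | "pseudo_inner n 1 e2 e2 < 0"
    using opp unit by fastforce
  then have "e3 = 0\<^sub>v n"
  proof cases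
    case 1
    then show ?thesis
      using D null by (intro timelike_orthogonal_null[OF assms, of e1])
  next
    case 2
    then show ?thesis
      using D null by (intro timelike_orthogonal_null[OF assms, of e2])
  qed
  with D show False
    by simp
qed

lemma no_elliptic_helicoid_second_kind_neutral:
  "\<not> elliptic_helicoid_second_kind 4 2 f"
proof
  assume "elliptic_helicoid_second_kind 4 2 f"
  then obtain e1 e2 e3 where
    sys: "distinct [e1, e2, e3]" "orthogonal_system 4 2 {e1, e2, e3}"
    and eq: "pseudo_inner 4 2 e1 e1 = pseudo_inner 4 2 e2 e2"
    and unit: "pseudo_inner 4 2 e1 e1 \<in> {1, -1}"
    and null: "pseudo_inner 4 2 e3 e3 = 0"
    unfolding elliptic_helicoid_second_kind_def by blast
  note D = orthogonal_system_tripleD[OF sys]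
  have neg: "v = 0\<^sub>v 4" if "v \<in> carrier_vec 4" "v $ 2 = 0" "v $ 3 = 0"
    "1 * pseudo_inner 4 2 v v \<ge> 0" for v
  proof (rule negative_definite_on_negative_axes[of v 4 2])
    show "v $ i = 0" if "2 \<le> i" "i < 4" for i
    proof -
      have "i = 2 \<or> i = 3"
        using that by linarith
      then show ?thesis
        using \<open>v $ 2 = 0\<close> \<open>v $ 3 = 0\<close> by blast
    qed
  qed (use that in simp_all)
  have pos: "v = 0\<^sub>v 4" if "v \<in> carrier_vec 4" "v $ 0 = 0" "v $ 1 = 0"
    "(-1) * pseudo_inner 4 2 v v \<ge> 0" for v
  proof (rule positive_definite_on_positive_axes[of v 4 2])
    show "v $ i = 0" if "i < 2" for i
      using that \<open>v $ 0 = 0\<close> \<open>v $ 1 = 0\<close> by (auto simp: less_2_cases_iff)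
  qed (use that in simp_all)
  consider "pseudo_inner 4 2 e1 e1 = 1" | "pseudo_inner 4 2 e1 e1 = -1"
    using unit by blast
  then have "e3 = 0\<^sub>v 4"
  proof cases
    case 1
    show ?thesis
      by (rule definite_pair_orthogonal_null[where i = 2 and j = 3 and \<sigma> = 1, OF _ _ _ _ neg D(1-3,5-7)])
        (use 1 null eq in simp_all)
  next
    case 2
    show ?thesis
      by (rule definite_pair_orthogonal_null[where i = 0 and j = 1 and \<sigma> = "-1", OF _ _ _ _ pos D(1-3,5-7)])
        (use 2 null eq in simp_all)
  qed
  with D show False
    by simp
qed

theorem theorem9:
  shows "(\<forall>n\<ge>3. \<nexists>f. hyperbolic_helicoid_second_kind n 1 f) \<and>
         (\<nexists>f. elliptic_helicoid_second_kind 4 2 f)"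
  using no_hyperbolic_helicoid_second_kind_Minkowski no_elliptic_helicoid_second_kind_neutral
  by (meson le_trans one_le_numeral)

end
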